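(* Let $(\mathcal{M},\overset{p}{\longmapsto},Emb,Proj)$ be a target for a factor system $(\mathcal{M}_{\mathcal{I}},\overset{p}{\mapsto},emb,proj)$. For $i\in\mathcal{I}$ define, on $\mathcal{M}$, $$a\approx_i b:\iff a\overset{p}{\longmapsto}a_i\text{ and }b\overset{p}{\longmapsto}b_i\text{ for some }a_i\asymp b_i\text{ in }\mathcal{M}_i,\qquad Pt_i:=Emb_i\circ Proj_i .$$ Then $(\mathcal{M},\approx_{\mathcal{I}},Pt_{\mathcal{I}})$ is a PER-set (with point sets $\mathcal{P}_i=\{Emb_i(a_i)\mid a_i\in\mathcal{M}_i\}$), which satisfies $Proj_i(Emb_i(a_i))\asymp a_i$ for all $i\in\mathcal{I}$ and $a_i\in\mathcal{M}_i$. If $\mathcal{M}_{\mathcal{I}}$ is stable, then $Emb=(Emb_i)_{i\in\mathcal{I}}:\mathcal{M}_{\mathcal{I}}\to\mathcal{AP}(\mathcal{M})$ (with the identity on $\mathcal{I}$) is a strong and surjective homomorphism of factor systems.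
   Context: Index sets $\mathcal{I},\mathcal{J},\dots$ are non-empty directed preordered sets (products carry the product order). For each index set $\mathcal{I}$ (including products) a set $\mathfrak{D}(\mathcal{I})\subseteq\mathcal{P}(\mathcal{I})$ is fixed. Standing assumptions: $\mathfrak{D}(\mathcal{I})$ is a proper filter of subsets of $\mathcal{I}$, all of whose members are cofinal, and it contains all non-empty up-sets; and if $\mathcal{H}\in\mathfrak{D}(\mathcal{I}\times\mathcal{J})$ and $\mathcal{I}'\in\mathfrak{D}(\mathcal{I})$, then $\{j\in\mathcal{J}\mid\exists i\in\mathcal{I}'\ (i,j)\in\mathcal{H}\}\in\mathfrak{D}(\mathcal{J})$. A system $(\mathcal{M}_{\mathcal{I}},\overset{p}{\mapsto})$ is a family of finite sets $(\mathcal{M}_i)_{i\in\mathcal{I}}$ (regarded as disjoint) with relations $\overset{p}{\mapsto}\subseteq\mathcal{M}_{i'}\times\mathcal{M}_i$ for $i'\ge i$, reflexive for $i=i'$. Elements $a_i\in\mathcal{M}_i$, $b_j\in\mathcal{M}_j$ are consistent, $a_i\asymp b_j$, iff there are $i'\ge i,j$ and $a_{i'}\in\mathcal{M}_{i'}$ with $a_{i'}\overset{p}{\mapsto}a_i$ and $a_{i'}\overset{p}{\mapsto}b_j$. A prefactor system is a system with $a_{i'}\asymp a_i\iff a_{i'}\overset{p}{\mapsto}a_i$ for all $i\le i'$. A system is stable iff $a_{i'}\overset{p}{\mapsto}a_i\asymp b_i$ implies $a_{i'}\overset{p}{\mapsto}b_i$ for all $i\le i'$. A factor system $(\mathcal{M}_{\mathcal{I}},\overset{p}{\mapsto},emb,proj)$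 is a prefactor system with $\asymp$-preserving maps $emb_i^{i'}:\mathcal{M}_i\to\mathcal{M}_{i'}$ and $proj_i^{i'}:\mathcal{M}_{i'}\to\mathcal{M}_i$ ($i\le i'$) such that, for $i\le i'\le i''$: $emb_i^i(a_i)\asymp a_i\asymp proj_i^i(a_i)$; $emb_{i'}^{i''}(emb_i^{i'}(a_i))\asymp emb_i^{i''}(a_i)$; $proj_i^{i'}(proj_{i'}^{i''}(a_{i''}))\asymp proj_i^{i''}(a_{i''})$; $proj_i^{i'}(emb_i^{i'}(a_i))\asymp a_i$; $a_{i'}\overset{p}{\mapsto}a_i\Rightarrow emb_{i'}^{i''}(a_{i'})\overset{p}{\mapsto}a_i$; $a_{i''}\overset{p}{\mapsto}a_i\Rightarrow proj_{i'}^{i''}(a_{i''})\overset{p}{\mapsto}a_i$. A target $(\mathcal{M},\overset{p}{\longmapsto},Emb,Proj)$ for it is a set $\mathcal{M}$ with relations $\overset{p}{\longmapsto}\subseteq\mathcal{M}\times\mathcal{M}_i$ and maps $Emb_i:\mathcal{M}_i\to\mathcal{M}$, $Proj_i:\mathcal{M}\to\mathcal{M}_i$ that extends the factor system by a top stage with the identity of $\mathcal{M}$ as $\overset{p}{\mapsto}$ (hence $\asymp$) on $\mathcal{M}$: $\{i\in\mathcal{I}\mid\exists a_i\in\mathcal{M}_i\ a\overset{p}{\longmapsto}a_i\}\in\mathfrak{D}(\mathcal{I})$ for all $a\in\mathcal{M}$; and for $i\le i'$: $a\overset{p}{\longmapsto}a_{i'}$, $a\overset{p}{\longmapsto}a_i$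 imply $a_{i'}\overset{p}{\mapsto}a_i$; $a_i\asymp b_i$ implies $Emb_i(a_i)=Emb_i(b_i)$; $Emb_{i'}(emb_i^{i'}(a_i))=Emb_i(a_i)$; $a_{i'}\overset{p}{\mapsto}a_i$ implies $Emb_{i'}(a_{i'})\overset{p}{\longmapsto}a_i$; $proj_i^{i'}(Proj_{i'}(a))\asymp Proj_i(a)$; $a\overset{p}{\longmapsto}a_i$ implies $Proj_{i'}(a)\overset{p}{\mapsto}a_i$; and $Proj_i(Emb_i(a_i))\asymp a_i$. For PERs (symmetric, transitive relations) $\approx_i$ on $\mathcal{M}$ put $[i]:=\{a\in\mathcal{M}\mid a\approx_i a\}$, $\mathcal{I}_a:=\{i\in\mathcal{I}\mid a\in[i]\}$. $(\mathcal{M},\approx_{\mathcal{I}})$ is a $\mathfrak{D}$-set iff each $\approx_i$ is a PER; $\mathcal{I}_a\in\mathfrak{D}(\mathcal{I})$ for all $a$; and $a\approx_{i'}b$, $a,b\in[i]$ imply $a\approx_i b$ for $i\le i'$. It is pointed, with $pt_{\mathcal{I}}$, iff there are $\mathcal{P}_i\subseteq\mathcal{M}$ and surjective maps $pt_i:[i]\to\mathcal{P}_i$ such that for all $a,b$ and $i\le i'$: $\mathcal{P}_i\subseteq\mathcal{P}_{i'}$; $a\approx_i b$ implies $a\approx_i pt_i(a)=pt_i(b)$; $a\in[i]\cap[i']$ implies $pt_{i'}(a)\in[i]$. A PER-set $(\mathcal{M},\approx_{\mathcal{I}},Pt_{\mathcal{I}})$ is a pointed $\mathfrak{D}$-set with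 maps $Pt_i:\mathcal{M}\to\mathcal{P}_i$ such that for all $i\le i'$: $Pt_i(a)=pt_i(a)$ for $a\in[i]$ (so $pt_i$ is the restriction of $Pt_i$ to $[i]$); $Pt_i=Pt_i\circ Pt_{i'}$; and $a\in[i]$ implies $Pt_{i'}(a)\in[i]$. The internal system $\mathcal{AP}(\mathcal{M})$ of a PER-set is the factor system $((\mathcal{P}_i)_{i\in\mathcal{I}},\overset{p}{\mapsto})$ with $a_{i'}\overset{p}{\mapsto}a_i:\iff a_{i'}\approx_i a_i$ for $a_{i'}\in\mathcal{P}_{i'}$, $a_i\in\mathcal{P}_i$, $i\le i'$, embeddings the inclusions $\mathcal{P}_i\hookrightarrow\mathcal{P}_{i'}$, and projections the restrictions of $Pt_i$ to $\mathcal{P}_{i'}$. A homomorphism of factor systems $\mathcal{M}_{\mathcal{I}}\to\mathcal{N}_{\mathcal{J}}$ consists of a monotone map $\Phi_0:\mathcal{I}\to\mathcal{J}$ and maps $\Phi^i:\mathcal{M}_i\to\mathcal{N}_{\Phi_0(i)}$ such that for $i\le i'$, $j=\Phi_0(i)$, $j'=\Phi_0(i')$: $a_{i'}\overset{p}{\mapsto}a_i\Rightarrow\Phi^{i'}(a_{i'})\overset{p}{\mapsto}\Phi^i(a_i)$, $\Phi^{i'}(emb_i^{i'}(a_i))=emb_j^{j'}(\Phi^i(a_i))$, $\Phi^i(proj_i^{i'}(a_{i'}))=proj_j^{j'}(\Phi^{i'}(a_{i'}))$. It is strong if the first implication is an equivalence, and surjective if all its maps are surjective. *)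

theory Defs
  imports "HOL-Library.FuncSet"
begin

text \<open>
  An index set is represented by its preorder \<open>r\<close>; as \<open>r\<close> is reflexive, the
  underlying set is \<^term>\<open>Field r\<close>, and \<open>i \<le> i'\<close> is \<^prop>\<open>(i, i') \<in> r\<close>.
\<close>

definition index_set :: "'i rel \<Rightarrow> bool" where
  "index_set r \<longleftrightarrow> Preorder r \<and> Field r \<noteq> {} \<and>
     (\<forall>i\<in>Field r. \<forall>j\<in>Field r. \<exists>k. (i, k) \<in> r \<and> (j, k) \<in> r)"

text \<open>
  All index sets live in one type \<open>'u\<close>, so that the choice of \<open>\<DD>\<close> can be a single
  function of the index set. Products stay in \<open>'u\<close> by means of an injective
  pairing \<open>pr\<close>.
\<close>

definition product_order :: "('u \<Rightarrow> 'u \<Rightarrow> 'u) \<Rightarrow> 'u rel \<Rightarrow> 'u rel \<Rightarrow> 'u rel" where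
  "product_order pr r s = {(pr i j, pr i' j') | i i' j j'. (i, i') \<in> r \<and> (j, j') \<in> s}"

definition cofinal_in :: "'i rel \<Rightarrow> 'i set \<Rightarrow> bool" where
  "cofinal_in r H \<longleftrightarrow> (\<forall>i\<in>Field r. \<exists>h\<in>H. (i, h) \<in> r)"

definition up_set :: "'i rel \<Rightarrow> 'i set \<Rightarrow> bool" where
  "up_set r U \<longleftrightarrow> U \<subseteq> Field r \<and> (\<forall>i\<in>U. \<forall>i'. (i, i') \<in> r \<longrightarrow> i' \<in> U)"

definition proper_filter_on :: "'i set \<Rightarrow> 'i set set \<Rightarrow> bool" where
  "proper_filter_on I \<F> \<longleftrightarrow> \<F> \<subseteq> Pow I \<and> I \<in> \<F> \<and> {} \<notin> \<F> \<and>
     (\<forall>A\<in>\<F>. \<forall>B\<in>\<F>. A \<inter> B \<in> \<F>) \<and> (\<forall>A\<in>\<F>. \<forall>B. A \<subseteq> B \<and> B \<subseteq> I \<longrightarrow> B \<in> \<F>)"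

locale index_choice =
  fixes pr :: "'u \<Rightarrow> 'u \<Rightarrow> 'u" and \<DD> :: "'u rel \<Rightarrow> 'u set set"
  assumes pr_inject: "pr i j = pr i' j' \<Longrightarrow> i = i' \<and> j = j'"
    and filter: "index_set r \<Longrightarrow> proper_filter_on (Field r) (\<DD> r)"
    and cofinal: "index_set r \<Longrightarrow> H \<in> \<DD> r \<Longrightarrow> cofinal_in r H"
    and up_sets: "index_set r \<Longrightarrow> up_set r U \<Longrightarrow> U \<noteq> {} \<Longrightarrow> U \<in> \<DD> r"
    and product: "index_set r \<Longrightarrow> index_set s \<Longrightarrow> H \<in> \<DD> (product_order pr r s) \<Longrightarrow> I' \<in> \<DD> r \<Longrightarrow>
      {j \<in> Field s. \<exists>i\<in>I'. pr i j \<in> H} \<in> \<DD> s"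

text \<open>
  The stages \<open>stg S i\<close> are regarded as disjoint: every relation and map carries the
  stages of its arguments as parameters. So \<open>(a', a) \<in> prel S i' i\<close> says that the
  element \<open>a'\<close> of stage \<open>i'\<close> is related by \<open>\<mapsto>\<close> to the element \<open>a\<close> of stage \<open>i\<close>, and
  \<open>consistent S i a j b\<close> is \<open>a\<^sub>i \<asymp> b\<^sub>j\<close>. The values of \<open>prel S i' i\<close> are irrelevant
  unless \<open>i \<le> i'\<close>. In \<open>femb F i i'\<close> and \<open>fproj F i i'\<close> the smaller index is always the
  first one: the former maps stage \<open>i\<close> to stage \<open>i'\<close>, the latter \<open>i'\<close> to \<open>i\<close>.
\<close>

record ('i, 'a) sys =
  idx :: "'i rel"
  stg :: "'i \<Rightarrow> 'a set"
  prel :: "'i \<Rightarrow> 'i \<Rightarrow> ('a \<times> 'a) set"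

record ('i, 'a) fsys = "('i, 'a) sys" +
  femb :: "'i \<Rightarrow> 'i \<Rightarrow> 'a \<Rightarrow> 'a"
  fproj :: "'i \<Rightarrow> 'i \<Rightarrow> 'a \<Rightarrow> 'a"

definition consistent :: "('i, 'a, 'z) sys_scheme \<Rightarrow> 'i \<Rightarrow> 'a \<Rightarrow> 'i \<Rightarrow> 'a \<Rightarrow> bool" where
  "consistent S i a j b \<longleftrightarrow> (\<exists>k. (i, k) \<in> idx S \<and> (j, k) \<in> idx S \<and>
     (\<exists>c\<in>stg S k. (c, a) \<in> prel S k i \<and> (c, b) \<in> prel S k j))"

locale system =
  fixes S :: "('i, 'a, 'z) sys_scheme"
  assumes index: "index_set (idx S)"
    and finite_stg: "i \<in> Field (idx S) \<Longrightarrow> finite (stg S i)"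
    and prel_subset: "(i, i') \<in> idx S \<Longrightarrow> prel S i' i \<subseteq> stg S i' \<times> stg S i"
    and prel_refl: "i \<in> Field (idx S) \<Longrightarrow> refl_on (stg S i) (prel S i i)"

locale prefactor_system = system +
  assumes consistent_iff: "(i, i') \<in> idx S \<Longrightarrow> a' \<in> stg S i' \<Longrightarrow> a \<in> stg S i \<Longrightarrow>
    consistent S i' a' i a \<longleftrightarrow> (a', a) \<in> prel S i' i"

definition stable :: "('i, 'a, 'z) sys_scheme \<Rightarrow> bool" where
  "stable S \<longleftrightarrow> (\<forall>(i, i')\<in>idx S. \<forall>a'\<in>stg S i'. \<forall>a\<in>stg S i. \<forall>b\<in>stg S i.
     (a', a) \<in> prel S i' i \<and> consistent S i a i b \<longrightarrow> (a', b) \<in> prel S i' i)"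

locale factor_system = prefactor_system F for F :: "('i, 'a, 'z) fsys_scheme" +
  assumes emb_closed: "(i, i') \<in> idx F \<Longrightarrow> femb F i i' \<in> stg F i \<rightarrow> stg F i'"
    and proj_closed: "(i, i') \<in> idx F \<Longrightarrow> fproj F i i' \<in> stg F i' \<rightarrow> stg F i"
    and emb_consistent: "(i, i') \<in> idx F \<Longrightarrow> a \<in> stg F i \<Longrightarrow> b \<in> stg F i \<Longrightarrow>
      consistent F i a i b \<Longrightarrow> consistent F i' (femb F i i' a) i' (femb F i i' b)"
    and proj_consistent: "(i, i') \<in> idx F \<Longrightarrow> a \<in> stg F i' \<Longrightarrow> b \<in> stg F i' \<Longrightarrow>
      consistent F i' a i' b \<Longrightarrow> consistent F i (fproj F i i' a) i (fproj F i i' b)"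
    and emb_id: "i \<in> Field (idx F) \<Longrightarrow> a \<in> stg F i \<Longrightarrow> consistent F i (femb F i i a) i a"
    and proj_id: "i \<in> Field (idx F) \<Longrightarrow> a \<in> stg F i \<Longrightarrow> consistent F i a i (fproj F i i a)"
    and emb_emb: "(i, i') \<in> idx F \<Longrightarrow> (i', i'') \<in> idx F \<Longrightarrow> a \<in> stg F i \<Longrightarrow>
      consistent F i'' (femb F i' i'' (femb F i i' a)) i'' (femb F i i'' a)"
    and proj_proj: "(i, i') \<in> idx F \<Longrightarrow> (i', i'') \<in> idx F \<Longrightarrow> a \<in> stg F i'' \<Longrightarrow>
      consistent F i (fproj F i i' (fproj F i' i'' a)) i (fproj F i i'' a)"
    and proj_emb: "(i, i') \<in> idx F \<Longrightarrow> a \<in> stg F i \<Longrightarrow>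
      consistent F i (fproj F i i' (femb F i i' a)) i a"
    and emb_prel: "(i, i') \<in> idx F \<Longrightarrow> (i', i'') \<in> idx F \<Longrightarrow> a' \<in> stg F i' \<Longrightarrow> a \<in> stg F i \<Longrightarrow>
      (a', a) \<in> prel F i' i \<Longrightarrow> (femb F i' i'' a', a) \<in> prel F i'' i"
    and proj_prel: "(i, i') \<in> idx F \<Longrightarrow> (i', i'') \<in> idx F \<Longrightarrow> a'' \<in> stg F i'' \<Longrightarrow> a \<in> stg F i \<Longrightarrow>
      (a'', a) \<in> prel F i'' i \<Longrightarrow> (fproj F i' i'' a'', a) \<in> prel F i' i"

record ('i, 'a, 'm) tgt =
  tcar :: "'m set"
  tprel :: "'i \<Rightarrow> ('m \<times> 'a) set"
  Emb :: "'i \<Rightarrow> 'a \<Rightarrow> 'm"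
  Proj :: "'i \<Rightarrow> 'm \<Rightarrow> 'a"

locale target =
  fixes \<DD> :: "'i rel \<Rightarrow> 'i set set"
    and F :: "('i, 'a, 'z) fsys_scheme"
    and T :: "('i, 'a, 'm, 'y) tgt_scheme"
  assumes tprel_subset: "i \<in> Field (idx F) \<Longrightarrow> tprel T i \<subseteq> tcar T \<times> stg F i"
    and Emb_closed: "i \<in> Field (idx F) \<Longrightarrow> Emb T i \<in> stg F i \<rightarrow> tcar T"
    and Proj_closed: "i \<in> Field (idx F) \<Longrightarrow> Proj T i \<in> tcar T \<rightarrow> stg F i"
    and tprel_large: "a \<in> tcar T \<Longrightarrow>
      {i \<in> Field (idx F). \<exists>x\<in>stg F i. (a, x) \<in> tprel T i} \<in> \<DD> (idx F)"
    and tprel_prel: "(i, i') \<in> idx F \<Longrightarrow> a \<in> tcar T \<Longrightarrow> x' \<in> stg F i' \<Longrightarrow> x \<in> stg F i \<Longrightarrow>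
      (a, x') \<in> tprel T i' \<Longrightarrow> (a, x) \<in> tprel T i \<Longrightarrow> (x', x) \<in> prel F i' i"
    and Emb_consistent: "i \<in> Field (idx F) \<Longrightarrow> x \<in> stg F i \<Longrightarrow> y \<in> stg F i \<Longrightarrow>
      consistent F i x i y \<Longrightarrow> Emb T i x = Emb T i y"
    and Emb_emb: "(i, i') \<in> idx F \<Longrightarrow> x \<in> stg F i \<Longrightarrow> Emb T i' (femb F i i' x) = Emb T i x"
    and Emb_tprel: "(i, i') \<in> idx F \<Longrightarrow> x' \<in> stg F i' \<Longrightarrow> x \<in> stg F i \<Longrightarrow>
      (x', x) \<in> prel F i' i \<Longrightarrow> (Emb T i' x', x) \<in> tprel T i"
    and proj_Proj: "(i, i') \<in> idx F \<Longrightarrow> a \<in> tcar T \<Longrightarrow>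
      consistent F i (fproj F i i' (Proj T i' a)) i (Proj T i a)"
    and Proj_prel: "(i, i') \<in> idx F \<Longrightarrow> a \<in> tcar T \<Longrightarrow> x \<in> stg F i \<Longrightarrow>
      (a, x) \<in> tprel T i \<Longrightarrow> (Proj T i' a, x) \<in> prel F i' i"
    and Proj_Emb: "i \<in> Field (idx F) \<Longrightarrow> x \<in> stg F i \<Longrightarrow>
      consistent F i (Proj T i (Emb T i x)) i x"

text \<open>
  The point sets \<open>\<P>\<^sub>i\<close> are a component \<open>pts\<close> of a PER-set; the surjections
  \<open>pt\<^sub>i : [i] \<rightarrow> \<P>\<^sub>i\<close> are not, being the restrictions of \<open>Pt\<^sub>i\<close>.
\<close>

record ('i, 'm) pers =
  pidx :: "'i rel"
  pcar :: "'m set"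
  per :: "'i \<Rightarrow> 'm rel"
  pts :: "'i \<Rightarrow> 'm set"
  Pt :: "'i \<Rightarrow> 'm \<Rightarrow> 'm"

text \<open>\<open>per_dom (R i)\<close> is \<open>[i]\<close>, so that \<open>\<I>\<^sub>a = {i. a \<in> per_dom (R i)}\<close>.\<close>

definition per_dom :: "'m rel \<Rightarrow> 'm set" where
  "per_dom R = {a. (a, a) \<in> R}"

locale D_set =
  fixes \<DD> :: "'i rel \<Rightarrow> 'i set set" and r :: "'i rel" and M :: "'m set" and R :: "'i \<Rightarrow> 'm rel"
  assumes index: "index_set r"
    and per_subset: "i \<in> Field r \<Longrightarrow> R i \<subseteq> M \<times> M"
    and per_sym: "i \<in> Field r \<Longrightarrow> sym (R i)"
    and per_trans: "i \<in> Field r \<Longrightarrow> trans (R i)"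
    and large: "a \<in> M \<Longrightarrow> {i \<in> Field r. a \<in> per_dom (R i)} \<in> \<DD> r"
    and per_mono: "(i, i') \<in> r \<Longrightarrow> (a, b) \<in> R i' \<Longrightarrow> a \<in> per_dom (R i) \<Longrightarrow> b \<in> per_dom (R i) \<Longrightarrow>
      (a, b) \<in> R i"

locale pointed_D_set = D_set +
  fixes P :: "'a \<Rightarrow> 'b set" and pt :: "'a \<Rightarrow> 'b \<Rightarrow> 'b"
  assumes P_subset: "i \<in> Field r \<Longrightarrow> P i \<subseteq> M"
    and pt_surj: "i \<in> Field r \<Longrightarrow> pt i ` per_dom (R i) = P i"
    and P_mono: "(i, i') \<in> r \<Longrightarrow> P i \<subseteq> P i'"
    and pt_per: "i \<in> Field r \<Longrightarrow> (a, b) \<in> R i \<Longrightarrow> (a, pt i a) \<in> R i \<and> pt i a = pt i b"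
    and pt_dom: "(i, i') \<in> r \<Longrightarrow> a \<in> per_dom (R i) \<Longrightarrow> a \<in> per_dom (R i') \<Longrightarrow>
      pt i' a \<in> per_dom (R i)"

locale PER_set =
  fixes \<DD> :: "'i rel \<Rightarrow> 'i set set" and X :: "('i, 'm, 'z) pers_scheme"
  assumes pointed: "\<exists>pt. pointed_D_set \<DD> (pidx X) (pcar X) (per X) (pts X) pt \<and>
      (\<forall>i\<in>Field (pidx X). \<forall>a\<in>per_dom (per X i). Pt X i a = pt i a)"
    and Pt_closed: "i \<in> Field (pidx X) \<Longrightarrow> Pt X i \<in> pcar X \<rightarrow> pts X i"
    and Pt_Pt: "(i, i') \<in> pidx X \<Longrightarrow> a \<in> pcar X \<Longrightarrow> Pt X i a = Pt X i (Pt X i' a)"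
    and Pt_dom: "(i, i') \<in> pidx X \<Longrightarrow> a \<in> per_dom (per X i) \<Longrightarrow> Pt X i' a \<in> per_dom (per X i)"

definition internal_system :: "('i, 'm, 'z) pers_scheme \<Rightarrow> ('i, 'm) fsys" where
  "internal_system X =
    \<lparr> idx = pidx X,
      stg = pts X,
      prel = (\<lambda>i' i. {(a', a). a' \<in> pts X i' \<and> a \<in> pts X i \<and> (a', a) \<in> per X i}),
      femb = (\<lambda>i i' a. a),
      fproj = (\<lambda>i i' a. Pt X i a) \<rparr>"

definition induced_per :: "('i, 'a, 'z) fsys_scheme \<Rightarrow> ('i, 'a, 'm, 'y) tgt_scheme \<Rightarrow> 'i \<Rightarrow> 'm rel" where
  "induced_per F T i = {(a, b). a \<in> tcar T \<and> b \<in> tcar T \<and>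
     (\<exists>x\<in>stg F i. \<exists>y\<in>stg F i. (a, x) \<in> tprel T i \<and> (b, y) \<in> tprel T i \<and> consistent F i x i y)}"

definition induced_PER_set :: "('i, 'a, 'z) fsys_scheme \<Rightarrow> ('i, 'a, 'm, 'y) tgt_scheme \<Rightarrow> ('i, 'm) pers" where
  "induced_PER_set F T =
    \<lparr> pidx = idx F,
      pcar = tcar T,
      per = induced_per F T,
      pts = (\<lambda>i. Emb T i ` stg F i),
      Pt = (\<lambda>i. Emb T i \<circ> Proj T i) \<rparr>"

locale factor_hom = source: factor_system F + dest: factor_system G
  for F :: "('i, 'a, 'z) fsys_scheme" and G :: "('j, 'b, 'y) fsys_scheme" +
  fixes \<Phi>\<^sub>0 :: "'i \<Rightarrow> 'j" and \<Phi> :: "'i \<Rightarrow> 'a \<Rightarrow> 'b"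
  assumes index_closed: "\<Phi>\<^sub>0 \<in> Field (idx F) \<rightarrow> Field (idx G)"
    and index_mono: "(i, i') \<in> idx F \<Longrightarrow> (\<Phi>\<^sub>0 i, \<Phi>\<^sub>0 i') \<in> idx G"
    and closed: "i \<in> Field (idx F) \<Longrightarrow> \<Phi> i \<in> stg F i \<rightarrow> stg G (\<Phi>\<^sub>0 i)"
    and hom_prel: "(i, i') \<in> idx F \<Longrightarrow> a' \<in> stg F i' \<Longrightarrow> a \<in> stg F i \<Longrightarrow>
      (a', a) \<in> prel F i' i \<Longrightarrow> (\<Phi> i' a', \<Phi> i a) \<in> prel G (\<Phi>\<^sub>0 i') (\<Phi>\<^sub>0 i)"
    and hom_emb: "(i, i') \<in> idx F \<Longrightarrow> a \<in> stg F i \<Longrightarrow>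
      \<Phi> i' (femb F i i' a) = femb G (\<Phi>\<^sub>0 i) (\<Phi>\<^sub>0 i') (\<Phi> i a)"
    and hom_proj: "(i, i') \<in> idx F \<Longrightarrow> a' \<in> stg F i' \<Longrightarrow>
      \<Phi> i (fproj F i i' a') = fproj G (\<Phi>\<^sub>0 i) (\<Phi>\<^sub>0 i') (\<Phi> i' a')"

locale strong_factor_hom = factor_hom +
  assumes hom_prel_iff: "(i, i') \<in> idx F \<Longrightarrow> a' \<in> stg F i' \<Longrightarrow> a \<in> stg F i \<Longrightarrow>
    (a', a) \<in> prel F i' i \<longleftrightarrow> (\<Phi> i' a', \<Phi> i a) \<in> prel G (\<Phi>\<^sub>0 i') (\<Phi>\<^sub>0 i)"

locale surjective_factor_hom = factor_hom +
  assumes index_surj: "\<Phi>\<^sub>0 ` Field (idx F) = Field (idx G)"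
    and stage_surj: "i \<in> Field (idx F) \<Longrightarrow> \<Phi> i ` stg F i = stg G (\<Phi>\<^sub>0 i)"

end

theory Submission
  imports Defs
begin

text \<open>
  Within one stage of a prefactor system consistency is an equivalence relation, and a target
  identifies two elements of a stage exactly if they are consistent. The key point is
  that \<open>a \<approx>\<^sub>i b\<close> only depends on which \<open>x \<in> \<M>\<^sub>i\<close> satisfy \<open>a \<mapsto> x\<close> and \<open>b \<mapsto> x\<close>; monotonicity of
  \<open>\<approx>\<close>, where \<open>\<mapsto>\<close> itself need not be transitive, follows by passing from consistent
  \<open>x', y'\<close> to the single element \<open>Emb x' = Emb y'\<close>. In the internal system consistency within a stage
  is equality, so all its axioms up to consistency become equations; stability is needed
  only for its prefactor property and for strength.
\<close>

section \<open>Consistency within one stage of a prefactor system\<close>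

context prefactor_system
begin

lemma consistent_sym: "consistent S i a j b \<Longrightarrow> consistent S j b i a"
  unfolding consistent_def by blast

lemma stage_refl: "i \<in> Field (idx S) \<Longrightarrow> (i, i) \<in> idx S"
  using index unfolding index_set_def preorder_on_def refl_on_def by blast

lemma idx_Field:
  assumes "(i, i') \<in> idx S"
  shows "i \<in> Field (idx S)" "i' \<in> Field (idx S)"
  using assms by (auto simp: Field_def)

lemma prel_stage_refl: "i \<in> Field (idx S) \<Longrightarrow> a \<in> stg S i \<Longrightarrow> (a, a) \<in> prel S i i"
  using prel_refl unfolding refl_on_def by blast

lemma consistent_stage_iff:
  "i \<in> Field (idx S) \<Longrightarrow> a \<in> stg S i \<Longrightarrow> b \<in> stg S i \<Longrightarrow> consistent S i a i b \<longleftrightarrow> (a, b) \<in> prel S i i"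
  using consistent_iff stage_refl by blast

lemma consistent_stage_refl: "i \<in> Field (idx S) \<Longrightarrow> a \<in> stg S i \<Longrightarrow> consistent S i a i a"
  using consistent_stage_iff prel_stage_refl by blast

text \<open>In a prefactor system both hypotheses become \<open>prel\<close> at stage
  \<open>i\<close>, with \<open>b\<close> on the left; so \<open>b\<close> itself witnesses that
  \<open>a\<close> and \<open>c\<close> are consistent.\<close>

lemma consistent_stage_trans:
  assumes i: "i \<in> Field (idx S)" and abc: "a \<in> stg S i" "b \<in> stg S i" "c \<in> stg S i"
    and ab: "consistent S i a i b" and bc: "consistent S i b i c"
  shows "consistent S i a i c"
proof -
  have "(b, a) \<in> prel S i i" "(b, c) \<in> prel S i i"
    using ab bc i abc consistent_stage_iff consistent_sym by blast+
  then show ?thesis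
    unfolding consistent_def using stage_refl[OF i] abc(2) by blast
qed

end

section \<open>Values of target elements at a stage\<close>

locale factor_target = factor_system F + target \<DD> F T
  for \<DD> :: "'i rel \<Rightarrow> 'i set set"
    and F :: "('i, 'a, 'z) fsys_scheme"
    and T :: "('i, 'a, 'm, 'y) tgt_scheme"
begin

lemma Emb_in: "i \<in> Field (idx F) \<Longrightarrow> x \<in> stg F i \<Longrightarrow> Emb T i x \<in> tcar T"
  using Emb_closed by blast

lemma Proj_in: "i \<in> Field (idx F) \<Longrightarrow> a \<in> tcar T \<Longrightarrow> Proj T i a \<in> stg F i"
  using Proj_closed by blast

lemma emb_in: "(i, i') \<in> idx F \<Longrightarrow> x \<in> stg F i \<Longrightarrow> femb F i i' x \<in> stg F i'"
  using emb_closed by blast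

lemma proj_in: "(i, i') \<in> idx F \<Longrightarrow> x \<in> stg F i' \<Longrightarrow> fproj F i i' x \<in> stg F i"
  using proj_closed by blast

lemma Emb_tprel_self: "i \<in> Field (idx F) \<Longrightarrow> x \<in> stg F i \<Longrightarrow> (Emb T i x, x) \<in> tprel T i"
  using Emb_tprel stage_refl prel_stage_refl by blast

text \<open>This is \<open>tprel_prel\<close> for two equal indices. Below, \<open>x\<close> is
  called a value of \<open>a\<close> at stage \<open>i\<close> if \<open>(a, x)\<close> lies in
  \<open>tprel T i\<close>; values are thus unique up to consistency.\<close>

lemma tprel_consistent:
  assumes i: "i \<in> Field (idx F)" and ax: "(a, x) \<in> tprel T i" and ay: "(a, y) \<in> tprel T i"
  shows "consistent F i x i y"
proof -
  have "a \<in> tcar T" "x \<in> stg F i" "y \<in> stg F i"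
    using tprel_subset[OF i] ax ay by auto
  then show ?thesis
    using tprel_prel[OF stage_refl[OF i]] ax ay consistent_stage_iff[OF i] by blast
qed

text \<open>If the two embeddings coincide, this one element has both \<open>x\<close> and
  \<open>y\<close> as values, which forces consistency. The converse is a target axiom.\<close>

lemma Emb_eq_iff:
  assumes "i \<in> Field (idx F)" "x \<in> stg F i" "y \<in> stg F i"
  shows "Emb T i x = Emb T i y \<longleftrightarrow> consistent F i x i y"
  using assms Emb_consistent tprel_consistent Emb_tprel_self by metis

section \<open>The induced partial equivalence relations\<close>

lemma induced_perI:
  assumes "i \<in> Field (idx F)" "(a, x) \<in> tprel T i" "(b, y) \<in> tprel T i" "consistent F i x i y"
  shows "(a, b) \<in> induced_per F T i"
  using assms tprel_subset unfolding induced_per_def by blast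

lemma induced_perE:
  assumes "(a, b) \<in> induced_per F T i"
  obtains x y where "a \<in> tcar T" "b \<in> tcar T" "x \<in> stg F i" "y \<in> stg F i"
    "(a, x) \<in> tprel T i" "(b, y) \<in> tprel T i" "consistent F i x i y"
  using assms unfolding induced_per_def by blast

lemma per_dom_induced_per:
  assumes i: "i \<in> Field (idx F)"
  shows "per_dom (induced_per F T i) = {a. \<exists>x\<in>stg F i. (a, x) \<in> tprel T i}"
  using consistent_stage_refl[OF i] tprel_subset[OF i]
  unfolding per_dom_def induced_per_def by blast

lemma sym_induced_per: "sym (induced_per F T i)"
  using consistent_sym unfolding sym_def induced_per_def by blast

lemma trans_induced_per:
  assumes i: "i \<in> Field (idx F)"
  shows "trans (induced_per F T i)"
proof (rule transI)
  fix a b c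
  assume "(a, b) \<in> induced_per F T i" "(b, c) \<in> induced_per F T i"
  then obtain x y y' z where
    mem: "x \<in> stg F i" "y \<in> stg F i" "y' \<in> stg F i" "z \<in> stg F i"
    and ax: "(a, x) \<in> tprel T i" and "(b, y) \<in> tprel T i" "(b, y') \<in> tprel T i"
    and cz: "(c, z) \<in> tprel T i" and xy: "consistent F i x i y" and yz: "consistent F i y' i z"
    by (elim induced_perE)
  \<comment> \<open>The two hypotheses may supply different values \<open>y\<close> and
    \<open>y'\<close> of the middle element \<open>b\<close>; being values of one element, they are
    consistent.\<close>
  then have "consistent F i y i y'"
    using tprel_consistent[OF i] by blast
  then have "consistent F i x i z"
    using xy yz mem consistent_stage_trans[OF i] by meson
  then show "(a, c) \<in> induced_per F T i"
    using induced_perI[OF i ax cz] by blast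
qed

lemma induced_per_mono:
  assumes ii: "(i, i') \<in> idx F" and ab: "(a, b) \<in> induced_per F T i'"
    and a: "a \<in> per_dom (induced_per F T i)" and b: "b \<in> per_dom (induced_per F T i)"
  shows "(a, b) \<in> induced_per F T i"
proof -
  note i = idx_Field[OF ii]
  obtain x' y' where ab': "a \<in> tcar T" "b \<in> tcar T" "x' \<in> stg F i'" "y' \<in> stg F i'"
    "(a, x') \<in> tprel T i'" "(b, y') \<in> tprel T i'" "consistent F i' x' i' y'"
    using ab by (elim induced_perE)
  obtain x y where xy: "x \<in> stg F i" "(a, x) \<in> tprel T i" "y \<in> stg F i" "(b, y) \<in> tprel T i"
    using a b unfolding per_dom_induced_per[OF i(1)] by blast
  \<comment> \<open>Both \<open>x'\<close> and \<open>x\<close> are values of \<open>a\<close>, so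
    \<open>tprel_prel\<close> relates them, and \<open>Emb_tprel\<close> moves the relation to the
    embedded element. The same applies to \<open>b\<close>.\<close>
  have "(Emb T i' x', x) \<in> tprel T i" "(Emb T i' y', y) \<in> tprel T i"
    using ab' xy ii tprel_prel Emb_tprel by meson+
  moreover have "Emb T i' x' = Emb T i' y'"
    using ab' Emb_consistent i by blast
  ultimately have "consistent F i x i y"
    using tprel_consistent[OF i(1)] by simp
  then show ?thesis
    using induced_perI i xy by blast
qed

section \<open>The point maps \<open>Emb T i \<circ> Proj T i\<close>\<close>

lemma Emb_Proj_eq:
  assumes i: "i \<in> Field (idx F)" and ax: "(a, x) \<in> tprel T i"
  shows "Emb T i (Proj T i a) = Emb T i x"
proof -
  have mem: "a \<in> tcar T" "x \<in> stg F i"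
    using ax tprel_subset[OF i] by auto
  \<comment> \<open>At equal indices \<open>Proj_prel\<close> makes the projection of
    \<open>a\<close> consistent with every value of \<open>a\<close>, and \<open>Emb\<close>
    identifies consistent elements.\<close>
  then have "(Proj T i a, x) \<in> prel F i i"
    using Proj_prel[OF stage_refl[OF i]] ax by blast
  then show ?thesis
    using Emb_consistent[OF i] consistent_stage_iff[OF i] Proj_in[OF i] mem by blast
qed

lemma Emb_Proj_Emb: "i \<in> Field (idx F) \<Longrightarrow> x \<in> stg F i \<Longrightarrow> Emb T i (Proj T i (Emb T i x)) = Emb T i x"
  using Emb_Proj_eq Emb_tprel_self by blast

text \<open>\<open>Proj_prel\<close> followed by \<open>Emb_tprel\<close>: passing to the point at a
  larger stage keeps all values at the smaller one. Hence \<open>[i]\<close> is invariant under the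
  later point maps.\<close>

lemma Emb_Proj_tprel:
  assumes "(i, i') \<in> idx F" "(a, x) \<in> tprel T i"
  shows "(Emb T i' (Proj T i' a), x) \<in> tprel T i"
proof -
  have "a \<in> tcar T" "x \<in> stg F i"
    using assms tprel_subset idx_Field by blast+
  then show ?thesis
    using assms Emb_tprel Proj_prel Proj_in idx_Field by meson
qed

text \<open>Up to consistency \<open>x\<close> is \<open>Proj T i' (Emb T i' x)\<close>, and for a
  projected target element \<open>proj_Proj\<close> gives the claim. This yields both the law for
  composed point maps and the compatibility of \<open>Emb\<close> with projections.\<close>

lemma Emb_proj:
  assumes ii: "(i, i') \<in> idx F" and x: "x \<in> stg F i'"
  shows "Emb T i (fproj F i i' x) = Emb T i (Proj T i (Emb T i' x))"
proof -
  note i = idx_Field[OF ii]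
  let ?a = "Emb T i' x"
  have a: "?a \<in> tcar T" and p: "Proj T i' ?a \<in> stg F i'"
    using Emb_in Proj_in i x by blast+
  have "consistent F i (fproj F i i' (Proj T i' ?a)) i (fproj F i i' x)"
    using proj_consistent[OF ii p x] Proj_Emb[OF i(2) x] by blast
  then have "Emb T i (fproj F i i' x) = Emb T i (fproj F i i' (Proj T i' ?a))"
    using Emb_consistent i proj_in[OF ii] p x by metis
  also have "\<dots> = Emb T i (Proj T i ?a)"
    using Emb_consistent[OF i(1)] proj_in[OF ii p] Proj_in[OF i(1) a] proj_Proj[OF ii a] by blast
  finally show ?thesis .
qed

lemma Emb_Proj_Emb_Proj:
  assumes ii: "(i, i') \<in> idx F" and a: "a \<in> tcar T"
  shows "Emb T i (Proj T i (Emb T i' (Proj T i' a))) = Emb T i (Proj T i a)"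
proof -
  note i = idx_Field[OF ii]
  have p: "Proj T i' a \<in> stg F i'"
    using Proj_in i a by blast
  have "Emb T i (fproj F i i' (Proj T i' a)) = Emb T i (Proj T i a)"
    using Emb_consistent[OF i(1)] proj_in[OF ii p] Proj_in[OF i(1) a] proj_Proj[OF ii a] by blast
  then show ?thesis
    using Emb_proj[OF ii p] by simp
qed

lemma Emb_image_mono:
  assumes "(i, i') \<in> idx F"
  shows "Emb T i ` stg F i \<subseteq> Emb T i' ` stg F i'"
proof (rule image_subsetI)
  fix x assume "x \<in> stg F i"
  then show "Emb T i x \<in> Emb T i' ` stg F i'"
    using assms Emb_emb emb_in by (metis imageI)
qed

text \<open>If \<open>a\<close> has the value \<open>x\<close>, its point is
  \<open>Emb T i x\<close>. This point again has the value \<open>x\<close>, and it does not change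
  when \<open>x\<close> is replaced by a consistent value of \<open>b\<close>.\<close>

lemma induced_per_Pt:
  assumes i: "i \<in> Field (idx F)" and ab: "(a, b) \<in> induced_per F T i"
  shows "(a, Emb T i (Proj T i a)) \<in> induced_per F T i"
    and "Emb T i (Proj T i a) = Emb T i (Proj T i b)"
proof -
  obtain x y where xy: "x \<in> stg F i" "y \<in> stg F i" "(a, x) \<in> tprel T i" "(b, y) \<in> tprel T i"
    "consistent F i x i y"
    using ab by (elim induced_perE)
  show "(a, Emb T i (Proj T i a)) \<in> induced_per F T i"
    using induced_perI[OF i xy(3)] xy Emb_Proj_tprel[OF stage_refl[OF i]] consistent_stage_refl[OF i]
    by blast
  show "Emb T i (Proj T i a) = Emb T i (Proj T i b)"
    using Emb_Proj_eq[OF i] xy Emb_consistent[OF i] by metis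
qed

lemma per_dom_Pt:
  assumes "(i, i') \<in> idx F" "a \<in> per_dom (induced_per F T i)"
  shows "Emb T i' (Proj T i' a) \<in> per_dom (induced_per F T i)"
  using assms per_dom_induced_per idx_Field Emb_Proj_tprel by blast

section \<open>The PER-set induced by the target\<close>

lemma pointed_D_set_induced:
  "pointed_D_set \<DD> (idx F) (tcar T) (induced_per F T) (\<lambda>i. Emb T i ` stg F i) (\<lambda>i. Emb T i \<circ> Proj T i)"
proof
  show "index_set (idx F)"
    by (rule index)
next
  fix i show "induced_per F T i \<subseteq> tcar T \<times> tcar T"
    unfolding induced_per_def by blast
next
  fix i show "sym (induced_per F T i)"
    by (rule sym_induced_per)
next
  fix i assume "i \<in> Field (idx F)"
  then show "trans (induced_per F T i)"
    by (rule trans_induced_per)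
next
  fix a assume "a \<in> tcar T"
  moreover have "{i \<in> Field (idx F). a \<in> per_dom (induced_per F T i)} =
      {i \<in> Field (idx F). \<exists>x\<in>stg F i. (a, x) \<in> tprel T i}"
    using per_dom_induced_per by blast
  ultimately show "{i \<in> Field (idx F). a \<in> per_dom (induced_per F T i)} \<in> \<DD> (idx F)"
    using tprel_large by simp
next
  fix i i' a b
  assume "(i, i') \<in> idx F" "(a, b) \<in> induced_per F T i'"
    "a \<in> per_dom (induced_per F T i)" "b \<in> per_dom (induced_per F T i)"
  then show "(a, b) \<in> induced_per F T i"
    by (rule induced_per_mono)
next
  fix i assume i: "i \<in> Field (idx F)"
  show "Emb T i ` stg F i \<subseteq> tcar T"
    using Emb_in[OF i] by blast
  show "(Emb T i \<circ> Proj T i) ` per_dom (induced_per F T i) = Emb T i ` stg F i"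
  proof
    show "(Emb T i \<circ> Proj T i) ` per_dom (induced_per F T i) \<subseteq> Emb T i ` stg F i"
      unfolding per_dom_induced_per[OF i] using Emb_Proj_eq[OF i] by auto
    show "Emb T i ` stg F i \<subseteq> (Emb T i \<circ> Proj T i) ` per_dom (induced_per F T i)"
    proof (rule image_subsetI)
      fix x assume x: "x \<in> stg F i"
      \<comment> \<open>For surjectivity each point is its own preimage.\<close>
      have "Emb T i x = (Emb T i \<circ> Proj T i) (Emb T i x)"
        using Emb_Proj_Emb[OF i x] by simp
      moreover have "Emb T i x \<in> per_dom (induced_per F T i)"
        unfolding per_dom_induced_per[OF i] using Emb_tprel_self[OF i x] x by blast
      ultimately show "Emb T i x \<in> (Emb T i \<circ> Proj T i) ` per_dom (induced_per F T i)"
        by (rule image_eqI)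
    qed
  qed
next
  fix i i' assume "(i, i') \<in> idx F"
  then show "Emb T i ` stg F i \<subseteq> Emb T i' ` stg F i'"
    by (rule Emb_image_mono)
next
  fix i a b assume "i \<in> Field (idx F)" "(a, b) \<in> induced_per F T i"
  then show "(a, (Emb T i \<circ> Proj T i) a) \<in> induced_per F T i \<and>
      (Emb T i \<circ> Proj T i) a = (Emb T i \<circ> Proj T i) b"
    using induced_per_Pt by simp
next
  fix i i' a
  assume "(i, i') \<in> idx F" "a \<in> per_dom (induced_per F T i)"
  then show "(Emb T i' \<circ> Proj T i') a \<in> per_dom (induced_per F T i)"
    using per_dom_Pt by simp
qed

lemma PER_set_induced: "PER_set \<DD> (induced_PER_set F T)"
proof
  \<comment> \<open>The witness is \<open>Pt\<close> itself, not cut down to \<open>[i]\<close>: the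
    conditions on \<open>pt\<close> concern only arguments in \<open>[i]\<close>.\<close>
  show "\<exists>pt. pointed_D_set \<DD> (pidx (induced_PER_set F T)) (pcar (induced_PER_set F T))
        (per (induced_PER_set F T)) (pts (induced_PER_set F T)) pt \<and>
      (\<forall>i\<in>Field (pidx (induced_PER_set F T)). \<forall>a\<in>per_dom (per (induced_PER_set F T) i).
        Pt (induced_PER_set F T) i a = pt i a)"
    using pointed_D_set_induced unfolding induced_PER_set_def by auto
qed (auto simp: induced_PER_set_def Proj_in Emb_Proj_Emb_Proj per_dom_Pt)

section \<open>The internal system of a stable factor system\<close>

lemma induced_per_Emb:
  assumes ii: "(i, i') \<in> idx F" and st: "stable F" and x': "x' \<in> stg F i'" and x: "x \<in> stg F i"
  shows "(Emb T i' x', Emb T i x) \<in> induced_per F T i \<longleftrightarrow> (x', x) \<in> prel F i' i"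
proof
  note i = idx_Field[OF ii]
  assume "(x', x) \<in> prel F i' i"
  then have "(Emb T i' x', x) \<in> tprel T i"
    using Emb_tprel[OF ii x' x] by blast
  then show "(Emb T i' x', Emb T i x) \<in> induced_per F T i"
    using induced_perI[OF i(1)] Emb_tprel_self[OF i(1) x] consistent_stage_refl[OF i(1) x] by blast
next
  note i = idx_Field[OF ii]
  assume "(Emb T i' x', Emb T i x) \<in> induced_per F T i"
  then obtain y z where yz: "y \<in> stg F i" "z \<in> stg F i" "(Emb T i' x', y) \<in> tprel T i"
    "(Emb T i x, z) \<in> tprel T i" "consistent F i y i z"
    by (elim induced_perE)
  have "consistent F i z i x"
    using tprel_consistent[OF i(1) yz(4)] Emb_tprel_self[OF i(1) x] by blast
  then have yx: "consistent F i y i x"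
    using consistent_stage_trans[OF i(1)] yz x by meson
  have "(x', y) \<in> prel F i' i"
    using tprel_prel[OF ii Emb_in[OF i(2) x'] x' yz(1)] Emb_tprel_self[OF i(2) x'] yz(3) by blast
  \<comment> \<open>So far \<open>x'\<close> is related to some \<open>y\<close> consistent with
    \<open>x\<close>; stability replaces \<open>y\<close> by \<open>x\<close>.\<close>
  then show "(x', x) \<in> prel F i' i"
    using st yx ii x' yz(1) x unfolding stable_def by blast
qed

abbreviation "AP \<equiv> internal_system (induced_PER_set F T)"

lemma AP_sel:
  "idx AP = idx F"
  "stg AP = (\<lambda>i. Emb T i ` stg F i)"
  "prel AP i' i = {(a', a). a' \<in> Emb T i' ` stg F i' \<and> a \<in> Emb T i ` stg F i \<and> (a', a) \<in> induced_per F T i}"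
  "femb AP i i' = (\<lambda>a. a)"
  "fproj AP i i' = (\<lambda>a. Emb T i (Proj T i a))"
  by (simp_all add: internal_system_def induced_PER_set_def)

lemma AP_prel_Emb_iff:
  assumes "stable F" "(i, i') \<in> idx F" "x' \<in> stg F i'" "x \<in> stg F i"
  shows "(Emb T i' x', Emb T i x) \<in> prel AP i' i \<longleftrightarrow> (x', x) \<in> prel F i' i"
  using assms induced_per_Emb by (simp add: AP_sel)

text \<open>Every candidate witness in the internal system is some \<open>Emb T k z\<close>, so
  witnesses correspond in both directions. Two stages are allowed because the prefactor property
  compares different stages.\<close>

lemma consistent_AP_Emb_iff:
  assumes st: "stable F" and i: "i \<in> Field (idx F)" and j: "j \<in> Field (idx F)"
    and x: "x \<in> stg F i" and y: "y \<in> stg F j"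
  shows "consistent AP i (Emb T i x) j (Emb T j y) \<longleftrightarrow> consistent F i x j y"
proof -
  have "((Emb T k z, Emb T i x) \<in> prel AP k i \<and> (Emb T k z, Emb T j y) \<in> prel AP k j) \<longleftrightarrow>
      ((z, x) \<in> prel F k i \<and> (z, y) \<in> prel F k j)"
    if "(i, k) \<in> idx F" "(j, k) \<in> idx F" "z \<in> stg F k" for k z
    using AP_prel_Emb_iff[OF st] that x y by simp
  \<comment> \<open>\<open>bex_simps\<close> turns the quantifier over the image of a stage under
    \<open>Emb\<close> into one over the stage itself.\<close>
  then show ?thesis
    unfolding consistent_def AP_sel(1,2) bex_simps by blast
qed

lemma consistent_AP_stage_iff:
  assumes st: "stable F" and i: "i \<in> Field (idx F)" and "a \<in> stg AP i" "b \<in> stg AP i"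
  shows "consistent AP i a i b \<longleftrightarrow> a = b"
  using assms consistent_AP_Emb_iff[OF st i i] Emb_eq_iff[OF i] by (auto simp: AP_sel(2))

lemma Emb_Proj_image: "i \<in> Field (idx F) \<Longrightarrow> a \<in> Emb T i ` stg F i \<Longrightarrow> Emb T i (Proj T i a) = a"
  using Emb_Proj_Emb by blast

lemma AP_proj_in:
  "i \<in> Field (idx F) \<Longrightarrow> a \<in> tcar T \<Longrightarrow> Emb T i (Proj T i a) \<in> Emb T i ` stg F i"
  using Proj_in by blast

lemma AP_stage_subset: "i \<in> Field (idx F) \<Longrightarrow> Emb T i ` stg F i \<subseteq> tcar T"
  using Emb_in by blast

text \<open>Elements of the stages are images under \<open>Emb\<close>, so both sides of the
  prefactor condition pull back to \<open>F\<close>, where it holds by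
  \<open>consistent_iff\<close>.\<close>

lemma prefactor_system_AP:
  assumes st: "stable F"
  shows "prefactor_system AP"
proof
  show "index_set (idx AP)"
    using index by (simp add: AP_sel)
next
  fix i assume "i \<in> Field (idx AP)"
  then show "finite (stg AP i)" "refl_on (stg AP i) (prel AP i i)"
    using finite_stg AP_prel_Emb_iff[OF st stage_refl] prel_stage_refl
    by (auto simp: AP_sel(1,2) refl_on_def)
next
  fix i i' assume "(i, i') \<in> idx AP"
  then show "prel AP i' i \<subseteq> stg AP i' \<times> stg AP i"
    by (auto simp: AP_sel)
next
  fix i i' a' a assume "(i, i') \<in> idx AP" "a' \<in> stg AP i'" "a \<in> stg AP i"
  then show "consistent AP i' a' i a \<longleftrightarrow> (a', a) \<in> prel AP i' i"
    using consistent_AP_Emb_iff[OF st] AP_prel_Emb_iff[OF st] consistent_iff idx_Field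
    by (auto simp: AP_sel(1,2))
qed

lemma factor_system_AP:
  assumes st: "stable F"
  shows "factor_system AP"
proof -
  interpret AP: prefactor_system AP
    using st by (rule prefactor_system_AP)
  note eq = consistent_AP_stage_iff[OF st]
  have emb: "a \<in> stg AP i'" if "(i, i') \<in> idx F" "a \<in> stg AP i" for i i' a
    using that Emb_image_mono unfolding AP_sel(2) by blast
  have car: "a \<in> tcar T" if "i \<in> Field (idx F)" "a \<in> stg AP i" for i a
    using that AP_stage_subset unfolding AP_sel(2) by blast
  have proj: "Emb T i (Proj T i a) \<in> stg AP i"
    if "i \<in> Field (idx F)" "a \<in> tcar T" for i a
    using that AP_proj_in by (simp add: AP_sel)
  have fix_pt: "Emb T i (Proj T i a) = a" if "i \<in> Field (idx F)" "a \<in> stg AP i" for i a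
    using that Emb_Proj_image by (simp add: AP_sel)
  show ?thesis
  proof (unfold_locales, unfold AP_sel(1,4,5))
    fix i i' assume ii: "(i, i') \<in> idx F"
    note i = idx_Field[OF ii]
    show "(\<lambda>a. a) \<in> stg AP i \<rightarrow> stg AP i'"
      using emb[OF ii] by blast
    show "(\<lambda>a. Emb T i (Proj T i a)) \<in> stg AP i' \<rightarrow> stg AP i"
      using proj[OF i(1) car[OF i(2)]] by blast
    show "consistent AP i' a i' b"
      if "a \<in> stg AP i" "b \<in> stg AP i" "consistent AP i a i b" for a b
      using that eq i emb[OF ii] by metis
    show "consistent AP i (Emb T i (Proj T i a)) i (Emb T i (Proj T i b))"
      if "a \<in> stg AP i'" "b \<in> stg AP i'" "consistent AP i' a i' b" for a b
      using that eq i proj[OF i(1) car[OF i(2)]] by metis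
    show "consistent AP i (Emb T i (Proj T i a)) i a" if "a \<in> stg AP i" for a
      using that eq i fix_pt by metis
    fix i'' assume ii'': "(i', i'') \<in> idx F"
    then have i'': "i'' \<in> Field (idx F)"
      by (rule idx_Field)
    have trans: "(i, i'') \<in> idx F"
      using index ii ii'' unfolding index_set_def preorder_on_def by (meson transD)
    show "consistent AP i'' a i'' a" if "a \<in> stg AP i" for a
      using that eq i'' emb[OF trans] by metis
    show "consistent AP i (Emb T i (Proj T i (Emb T i' (Proj T i' a)))) i (Emb T i (Proj T i a))"
      if "a \<in> stg AP i''" for a
      using that eq i car[OF i''] proj Emb_Proj_Emb_Proj[OF ii] by metis
    \<comment> \<open>On points the relation down to stage \<open>i\<close> is
      \<open>induced_per F T i\<close>, whatever the upper stage; only membership of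
      \<open>a'\<close> in the larger point set has to be checked.\<close>
    show "(a', a) \<in> prel AP i'' i"
      if "a' \<in> stg AP i'" "a \<in> stg AP i" "(a', a) \<in> prel AP i' i" for a' a
      using that emb[OF ii''] by (simp add: AP_sel(2,3))
    show "(Emb T i' (Proj T i' a''), a) \<in> prel AP i' i"
      if "a'' \<in> stg AP i''" "a \<in> stg AP i" "(a'', a) \<in> prel AP i'' i" for a'' a
    proof -
      obtain x y where "(a'', x) \<in> tprel T i" "(a, y) \<in> tprel T i" "consistent F i x i y"
        using \<open>(a'', a) \<in> prel AP i'' i\<close> by (auto simp: AP_sel(3) elim: induced_perE)
      \<comment> \<open>The point of \<open>a''\<close> at stage \<open>i'\<close> inherits the
        value \<open>x\<close> of \<open>a''\<close> at stage \<open>i\<close>.\<close>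
      then have "(Emb T i' (Proj T i' a''), a) \<in> induced_per F T i"
        using Emb_Proj_tprel[OF ii] induced_perI[OF i(1)] by blast
      then show ?thesis
        using that proj[OF i(2) car[OF i'']] by (simp add: AP_sel(2,3))
    qed
  next
    fix i a assume "i \<in> Field (idx F)" "a \<in> stg AP i"
    then show "consistent AP i a i a" "consistent AP i a i (Emb T i (Proj T i a))"
      using eq fix_pt by metis+
  qed
qed

section \<open>The embeddings as a strong and surjective homomorphism\<close>

lemma factor_hom_Emb:
  assumes st: "stable F"
  shows "factor_hom F AP (\<lambda>i. i) (Emb T)"
proof -
  interpret AP: factor_system AP
    using st by (rule factor_system_AP)
  show ?thesis
    \<comment> \<open>Compatibility with embeddings and projections holds as equality: the
      embeddings of the internal system are inclusions, which reduces the first to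
      \<open>Emb_emb\<close>, and the second is \<open>Emb_proj\<close>.\<close>
    by unfold_locales
      (simp_all add: AP_sel(1,2,4,5) AP_prel_Emb_iff[OF st] Emb_emb Emb_proj)
qed

lemma strong_surjective_factor_hom_Emb:
  assumes st: "stable F"
  shows "strong_factor_hom F AP (\<lambda>i. i) (Emb T)" "surjective_factor_hom F AP (\<lambda>i. i) (Emb T)"
proof -
  interpret factor_hom F AP "\<lambda>i. i" "Emb T"
    using st by (rule factor_hom_Emb)
  show "strong_factor_hom F AP (\<lambda>i. i) (Emb T)"
    by unfold_locales (simp add: AP_prel_Emb_iff[OF st])
  show "surjective_factor_hom F AP (\<lambda>i. i) (Emb T)"
    by unfold_locales (simp_all add: AP_sel(1,2))
qed

end

theorem proposition3p23:
  fixes pr :: "'u \<Rightarrow> 'u \<Rightarrow> 'u"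
    and \<DD> :: "'u rel \<Rightarrow> 'u set set"
    and F :: "('u, 'a) fsys"
    and T :: "('u, 'a, 'm) tgt"
  assumes "index_choice pr \<DD>"
    and "factor_system F"
    and "target \<DD> F T"
  shows "PER_set \<DD> (induced_PER_set F T) \<and>
    (\<forall>i\<in>Field (idx F). \<forall>x\<in>stg F i. consistent F i (Proj T i (Emb T i x)) i x) \<and>
    (stable F \<longrightarrow>
      strong_factor_hom F (internal_system (induced_PER_set F T)) (\<lambda>i. i) (Emb T) \<and>
      surjective_factor_hom F (internal_system (induced_PER_set F T)) (\<lambda>i. i) (Emb T))"
proof -
  interpret factor_target \<DD> F T
    using assms(2,3) by (rule factor_target.intro)
  show ?thesis
    using PER_set_induced Proj_Emb strong_surjective_factor_hom_Emb by blast
qed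

end
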